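(* Let $U=(u_{ij})_{i,j\in\mathbb{Z}}$ be a $\mathbb{Z}\times\mathbb{Z}$ matrix whose scalar entries depend on $\boldsymbol{t}=(t_1,t_2,\ldots)$ and which satisfies $$\frac{\partial U}{\partial t_k}=\Lambda^kU-U\Lambda^{-k}-U\mathcal{O}_kU,\qquad k=1,2,\ldots.$$ Then the matrix $g=E-U\Omega$ satisfies $$\frac{\partial g}{\partial t_k}=(\Lambda^k-U\mathcal{O}_k)g-g\Lambda^k,\qquad k=1,2,\ldots.$$
   Context: All matrices are indexed by $\mathbb{Z}\times\mathbb{Z}$; $E_{ij}$ is the matrix unit with $1$ at position $(i,j)$ and $0$ elsewhere, and $E$ is the unit matrix. For $k\in\mathbb{Z}$, $\Lambda^k=\sum_{i\in\mathbb{Z}}E_{i,i+k}$ (shift matrices). For $k\ge 1$, $\mathcal{O}_k=\sum_{i=0}^{k-1}E_{i,k-i-1}$. Also $\Omega=\sum_{i=0}^\infty E_{i,-i-1}$. All matrix products occurring here involve only finite sums in each entry. Derivatives of matrices are entrywise. *)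

theory Defs
  imports Complex_Main "HOL-Library.Groups_Big_Fun"
begin

type_synonym 'a zmat = "int \<Rightarrow> int \<Rightarrow> 'a"

definition E_unit :: "int \<Rightarrow> int \<Rightarrow> 'a::zero_neq_one zmat" where
  "E_unit i j = (\<lambda>a b. if a = i \<and> b = j then 1 else 0)"

definition E_id :: "'a::zero_neq_one zmat" where
  "E_id = (\<lambda>a b. if a = b then 1 else 0)"

(* Sum_any adds up the finitely many nonzero terms; it is 0 if there are
   infinitely many, which happens for none of the products formed below. *)

definition zmat_mult :: "'a::semiring_0 zmat \<Rightarrow> 'a zmat \<Rightarrow> 'a zmat" (infixl \<open>\<odot>\<close> 70) where
  "A \<odot> B = (\<lambda>a b. Sum_any (\<lambda>l. A a l * B l b))"

definition Lambda_pow :: "int \<Rightarrow> 'a::semiring_1 zmat" where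
  "Lambda_pow k = (\<lambda>a b. Sum_any (\<lambda>i. E_unit i (i + k) a b))"

definition O_mat :: "nat \<Rightarrow> 'a::semiring_1 zmat" where
  "O_mat k = (\<lambda>a b. \<Sum>i\<in>{0..<k}. E_unit (int i) (int k - int i - 1) a b)"

definition Omega_mat :: "'a::semiring_1 zmat" where
  "Omega_mat = (\<lambda>a b. Sum_any (\<lambda>i::nat. E_unit (int i) (- int i - 1) a b))"

lemma Lambda_pow_entry: "Lambda_pow k a b = (if b = a + k then 1 else 0)"
proof -
  have "{i. E_unit i (i + k) a b \<noteq> (0::'a)} = (if b = a + k then {a} else {})"
    by (auto simp: E_unit_def)
  then show ?thesis
    by (simp add: Lambda_pow_def Sum_any.expand_set) (simp add: E_unit_def)
qed

lemma O_mat_entry: "O_mat k a b = (if 0 \<le> a \<and> a < int k \<and> b = int k - a - 1 then 1 else 0)"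
proof (cases "0 \<le> a \<and> a < int k \<and> b = int k - a - 1")
  case True
  then have "O_mat k a b = (\<Sum>i\<in>{0..<k}. if i = nat a then 1 else (0::'a))"
    unfolding O_mat_def E_unit_def by (intro sum.cong) auto
  also have "\<dots> = 1" using True by (simp add: sum.delta nat_less_iff)
  finally show ?thesis using True by simp
next
  case False
  then show ?thesis unfolding O_mat_def E_unit_def by (auto intro!: sum.neutral)
qed

lemma Omega_mat_entry: "Omega_mat a b = (if 0 \<le> a \<and> b = - a - 1 then 1 else 0)"
proof -
  have "{i. E_unit (int i) (- int i - 1) a b \<noteq> (0::'a)} =
      (if 0 \<le> a \<and> b = - a - 1 then {nat a} else {})"
    by (auto simp: E_unit_def)
  then show ?thesis
    by (simp add: Omega_mat_def Sum_any.expand_set) (auto simp: E_unit_def)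
qed

(* The times t_1, t_2, ... are the values t 1, t 2, ... of a sequence t; the
   component t 0 plays no role.  The relation below says that the partial
   derivative with respect to t k of every entry of F exists at t, and that
   these derivatives form the matrix M. *)

definition has_time_derivative ::
    "((nat \<Rightarrow> 'a) \<Rightarrow> 'a zmat) \<Rightarrow> nat \<Rightarrow> 'a::real_normed_field zmat \<Rightarrow> (nat \<Rightarrow> 'a) \<Rightarrow> bool" where
  "has_time_derivative F k M t \<longleftrightarrow>
     (\<forall>a b. ((\<lambda>s. F (t(k := s)) a b) has_field_derivative M a b) (at (t k)))"

end

(* Right multiplication by Omega kills the columns with nonnegative index and reflects the
   others, so g = E - U Omega is affine in U and inherits entrywise derivatives. Modulo the
   equation for U, the claim is the identity U Lambda^(-k) Omega = U Omega Lambda^k - U O_k,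
   which holds because Lambda^(-k) Omega and Omega Lambda^k differ exactly in the k entries
   of O_k. *)

theory Submission imports Defs begin

text \<open>Reduces \<open>Sum_any\<close>, with its default 0 on infinite support, to an ordinary
  finite sum; exhibiting a suitable \<open>S\<close> also settles convergence.\<close>

lemma zmat_mult_eq_sum:
  assumes "finite S" "\<And>l. l \<notin> S \<Longrightarrow> A a l * B l b = 0"
  shows "(A \<odot> B) a b = (\<Sum>l\<in>S. A a l * B l b)"
  unfolding zmat_mult_def using assms by (intro Sum_any.expand_superset) auto

lemma Lambda_pow_mult: "(Lambda_pow k \<odot> A) a b = A (a + k) b"
  by (subst zmat_mult_eq_sum[of "{a + k}"]) (auto simp: Lambda_pow_entry)

lemma mult_Lambda_pow: "(A \<odot> Lambda_pow k) a b = A a (b - k)"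
  by (subst zmat_mult_eq_sum[of "{b - k}"]) (auto simp: Lambda_pow_entry)

lemma mult_Omega_mat: "(A \<odot> Omega_mat) a b = (if b < 0 then A a (- b - 1) else 0)"
  by (subst zmat_mult_eq_sum[of "{- b - 1}"]) (auto simp: Omega_mat_entry)

lemma mult_O_mat:
  "(A \<odot> O_mat k) a b = (if 0 \<le> b \<and> b < int k then A a (int k - b - 1) else 0)"
  by (subst zmat_mult_eq_sum[of "{int k - b - 1}"]) (auto simp: O_mat_entry)

lemma mult_O_mat_mult:
  "(A \<odot> O_mat k \<odot> B) a b = (\<Sum>l\<in>{0..<int k}. A a (int k - l - 1) * B l b)"
  by (subst zmat_mult_eq_sum[of "{0..<int k}"]) (auto simp: mult_O_mat)

text \<open>Distributivity can fail for \<open>Sum_any\<close> in general. Here row \<open>a\<close>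
  of each left factor has finite support, so \<open>B\<close> may be arbitrary.\<close>

lemma Lambda_pow_diff_mult_O_mat_mult:
  fixes A B :: "'a::ring_1 zmat"
  shows "((Lambda_pow m - A \<odot> O_mat k) \<odot> B) a b = B (a + m) b - (A \<odot> O_mat k \<odot> B) a b"
proof -
  \<comment> \<open>Row \<open>a\<close> of \<open>Lambda_pow m\<close> lives in column
    \<open>a + m\<close>, that of \<open>A \<odot> O_mat k\<close> in columns 0 to k - 1.\<close>
  let ?S = "insert (a + m) {0..<int k}"
  have "((Lambda_pow m - A \<odot> O_mat k) \<odot> B) a b
      = (\<Sum>l\<in>?S. (Lambda_pow m - A \<odot> O_mat k) a l * B l b)"
    by (rule zmat_mult_eq_sum) (auto simp: Lambda_pow_entry mult_O_mat)
  also have "\<dots> = (\<Sum>l\<in>?S. Lambda_pow m a l * B l b) - (\<Sum>l\<in>?S. (A \<odot> O_mat k) a l * B l b)"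
    by (simp only: fun_diff_def left_diff_distrib sum_subtractf)
  also have "(\<Sum>l\<in>?S. Lambda_pow m a l * B l b) = (Lambda_pow m \<odot> B) a b"
    by (rule zmat_mult_eq_sum[symmetric]) (auto simp: Lambda_pow_entry)
  also have "(\<Sum>l\<in>?S. (A \<odot> O_mat k) a l * B l b) = (A \<odot> O_mat k \<odot> B) a b"
    by (rule zmat_mult_eq_sum[symmetric]) (auto simp: mult_O_mat)
  finally show ?thesis by (simp only: Lambda_pow_mult)
qed

text \<open>The sum over \<open>l\<close> runs only through 0 \<le> l < k. For b < 0 the diagonal
  index l = b is thus never met and only the Omega part survives; for b \<ge> 0 the Omega part
  vanishes.\<close>

lemma mult_O_mat_mult_E_id_diff_Omega:
  fixes A B :: "'a::ring_1 zmat"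
  shows "(A \<odot> O_mat k \<odot> (E_id - B \<odot> Omega_mat)) a b
    = (if b < 0 then - (A \<odot> O_mat k \<odot> B) a (- b - 1) else (A \<odot> O_mat k) a b)"
proof (cases "b < 0")
  case True
  then show ?thesis
    by (auto simp: mult_O_mat_mult mult_Omega_mat E_id_def sum_negf[symmetric] intro!: sum.cong)
next
  case False
  have "(A \<odot> O_mat k \<odot> (E_id - B \<odot> Omega_mat)) a b
      = (\<Sum>l\<in>{0..<int k}. if l = b then A a (int k - l - 1) else 0)"
    unfolding mult_O_mat_mult using False
    by (intro sum.cong) (auto simp: mult_Omega_mat E_id_def)
  then show ?thesis using False by (simp add: mult_O_mat)
qed

theorem proposition1:
  fixes U g :: "(nat \<Rightarrow> 'a::real_normed_field) \<Rightarrow> 'a zmat"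
    and T :: "(nat \<Rightarrow> 'a) set"
  assumes U_eq: "\<And>t k. t \<in> T \<Longrightarrow> k \<ge> 1 \<Longrightarrow>
      has_time_derivative U k
        (Lambda_pow (int k) \<odot> U t - U t \<odot> Lambda_pow (- int k) - U t \<odot> O_mat k \<odot> U t) t"
    and g_def: "\<And>t. g t = E_id - U t \<odot> Omega_mat"
  shows "\<forall>t\<in>T. \<forall>k\<ge>1.
      has_time_derivative g k
        ((Lambda_pow (int k) - U t \<odot> O_mat k) \<odot> g t - g t \<odot> Lambda_pow (int k)) t"
proof (intro ballI allI impI)
  fix t and k :: nat
  assume "t \<in> T" "1 \<le> k"
  let ?M = "Lambda_pow (int k) \<odot> U t - U t \<odot> Lambda_pow (- int k) - U t \<odot> O_mat k \<odot> U t"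
  let ?N = "(Lambda_pow (int k) - U t \<odot> O_mat k) \<odot> g t - g t \<odot> Lambda_pow (int k)"
  \<comment> \<open>Needed at arbitrary \<open>s\<close>: the varied point \<open>t(k := s)\<close>
    may leave \<open>T\<close>.\<close>
  have g_entry: "g s a b = E_id a b - (if b < 0 then U s a (- b - 1) else 0)" for s a b
    by (simp add: g_def mult_Omega_mat)
  \<comment> \<open>Entrywise form of \<open>?N\<close> = -
    \<open>?M \<odot> Omega_mat\<close>.\<close>
  have N_entry: "?N a b = (if b < 0 then - ?M a (- b - 1) else 0)" for a b
  proof -
    have N: "?N a b = g t (a + int k) b - (U t \<odot> O_mat k \<odot> g t) a b - g t a (b - int k)"
      by (simp add: Lambda_pow_diff_mult_O_mat_mult mult_Lambda_pow)
    have UOg: "(U t \<odot> O_mat k \<odot> g t) a b =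
        (if b < 0 then - (U t \<odot> O_mat k \<odot> U t) a (- b - 1) else (U t \<odot> O_mat k) a b)"
      by (simp only: g_def mult_O_mat_mult_E_id_diff_Omega)
    \<comment> \<open>The two shifted diagonals from \<open>E_id\<close> cancel. For 0 \<le> b < k
      column b - k is negative, so \<open>g t a (b - int k)\<close> contributes
      \<open>U t a (int k - b - 1)\<close>, which cancels the entry of
      \<open>U t \<odot> O_mat k\<close>.\<close>
    show ?thesis
      unfolding N UOg
      by (auto simp: g_entry E_id_def Lambda_pow_mult mult_Lambda_pow mult_O_mat algebra_simps)
  qed
  have U_deriv: "((\<lambda>s. U (t(k := s)) a b) has_field_derivative ?M a b) (at (t k))" for a b
    using U_eq[OF \<open>t \<in> T\<close> \<open>1 \<le> k\<close>] unfolding has_time_derivative_def by blast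
  have "((\<lambda>s. g (t(k := s)) a b) has_field_derivative ?N a b) (at (t k))" for a b
  proof (cases "b < 0")
    case True
    then show ?thesis
      using DERIV_diff[OF DERIV_const[of "E_id a b"] U_deriv[of a "- b - 1"]]
      by (simp only: g_entry N_entry if_True diff_0)
  next
    case False
    then show ?thesis by (simp only: g_entry N_entry if_False DERIV_const)
  qed
  then show "has_time_derivative g k ?N t"
    unfolding has_time_derivative_def by blast
qed

end
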